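(* Let $p$ be a prime, $q=p^e>4$, and let $\ell$ be a positive integer with $2\ell\mid e$. Let $\boldsymbol a=(a_1,\ldots,a_n)$ be a vector of pairwise distinct elements of $\mathbb F_q$ and put $u_j=\prod_{1\le i\le n,\,i\ne j}(a_j-a_i)^{-1}$. Assume that $a_j\ne0$ and $a_j^{-1}u_j\in\mathbb F_{p^\ell}^{*}$ for $1\le j\le n$. Suppose that $\frac{n}{p^\ell+1}\in\mathbb Z_{>0}$ and put $k=\xi+1+\frac{n}{p^\ell+1}$. If $\xi$ and $s$ are integers with $0\le \xi\le\min\left\{p^\ell-1,\left\lfloor\frac{\frac{n}{p^\ell+1}-1}{p^\ell}\right\rfloor\right\}$ and $\xi+1\le s\le\min\{\xi+p^\ell,k-1\}$, then there exists an $[n+s,k]_q$ generalized Roth-Lempel code $C$ with a $(k-s)$-dimensional $\ell$-Galois hull, i.e. $\dim(\operatorname{Hull}_\ell(C))=k-s$.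
   Context: For $q=p^e$ and $0\le\ell\le e-1$, the $\ell$-Galois inner product on $\mathbb F_q^N$ is $\langle\boldsymbol x,\boldsymbol y\rangle_\ell=\sum_i x_iy_i^{p^\ell}$. For a linear code $C\subseteq\mathbb F_q^N$, $C^{\perp_\ell}=\{\boldsymbol x\in\mathbb F_q^N:\langle\boldsymbol c,\boldsymbol x\rangle_\ell=0\ \text{for all }\boldsymbol c\in C\}$ and the $\ell$-Galois hull is $\operatorname{Hull}_\ell(C)=C\cap C^{\perp_\ell}$. Generalized Roth-Lempel (GRL) code: let $1\le s\le k\le n$, let $\boldsymbol a\in\mathbb F_q^n$ have pairwise distinct entries, let $\boldsymbol v\in(\mathbb F_q^* )^n$ and $A_s\in\operatorname{GL}_s(\mathbb F_q)$. Then $\operatorname{GRL}_k(\boldsymbol a,\boldsymbol v,A_s)$ is the $[n+s,k]_q$ linear code $$\{(v_1f(a_1),\ldots,v_nf(a_n),(f_{k-s},\ldots,f_{k-1})A_s): f(x)=\textstyle\sum_{j=0}^{k-1}f_jx^j\in\mathbb F_q[x]\}.$$ An $[N,k]_q$ code is a $k$-dimensional subspace of $\mathbb F_q^N$. *)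

theory Defs
  imports
    "Jordan_Normal_Form.VS_Connect"
    "HOL-Algebra.Subrings"
    "HOL-Computational_Algebra.Polynomial"
begin

(* The finite field F_q is a type 'a :: {field, finite} with q = p ^ e elements;
   F_q^N is carrier_vec N.  Coordinates are indexed from 0. *)

definition galois_inner :: "nat \<Rightarrow> nat \<Rightarrow> 'a::field vec \<Rightarrow> 'a vec \<Rightarrow> 'a" where
  "galois_inner p l x y = (\<Sum>i<dim_vec x. x $ i * (y $ i) ^ (p ^ l))"

definition galois_dual :: "nat \<Rightarrow> nat \<Rightarrow> nat \<Rightarrow> 'a::field vec set \<Rightarrow> 'a vec set" where
  "galois_dual p l N C = {x \<in> carrier_vec N. \<forall>c\<in>C. galois_inner p l c x = 0}"

definition galois_hull :: "nat \<Rightarrow> nat \<Rightarrow> nat \<Rightarrow> 'a::field vec set \<Rightarrow> 'a vec set" where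
  "galois_hull p l N C = C \<inter> galois_dual p l N C"

definition code_dim :: "nat \<Rightarrow> 'a::field vec set \<Rightarrow> nat" where
  "code_dim N C = vectorspace.dim class_ring ((module_vec TYPE('a) N)\<lparr>carrier := C\<rparr>)"

definition linear_code :: "nat \<Rightarrow> nat \<Rightarrow> 'a::field vec set \<Rightarrow> bool" where
  "linear_code N k C \<longleftrightarrow>
     VectorSpace.subspace class_ring C (module_vec TYPE('a) N) \<and> code_dim N C = k"

definition GRL_params ::
  "nat \<Rightarrow> nat \<Rightarrow> nat \<Rightarrow> 'a::field vec \<Rightarrow> 'a vec \<Rightarrow> 'a mat \<Rightarrow> bool" where
  "GRL_params n k s a v A \<longleftrightarrow>
     1 \<le> s \<and> s \<le> k \<and> k \<le> n \<and>
     a \<in> carrier_vec n \<and> (\<forall>i<n. \<forall>j<n. i \<noteq> j \<longrightarrow> a $ i \<noteq> a $ j) \<and>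
     v \<in> carrier_vec n \<and> (\<forall>i<n. v $ i \<noteq> 0) \<and>
     A \<in> carrier_mat s s \<and> invertible_mat A"

(* The row vector (f_{k-s},...,f_{k-1}) times A is written as the transpose of A
   applied to the column vector. *)
definition GRL_code ::
  "nat \<Rightarrow> nat \<Rightarrow> nat \<Rightarrow> 'a::field vec \<Rightarrow> 'a vec \<Rightarrow> 'a mat \<Rightarrow> 'a vec set" where
  "GRL_code n k s a v A =
     {vec n (\<lambda>i. v $ i * poly f (a $ i)) @\<^sub>v
        (transpose_mat A *\<^sub>v vec s (\<lambda>j. Polynomial.coeff f (k - s + j)))
      | f. Polynomial.degree f < k}"

end

theory Submission
  imports Defs "HOL-Number_Theory.Residues"
begin

text \<open>Put Q = p^l and m = n/(Q+1). Elements of the subfield with Q elements are (Q+1)-st powers, so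
  we can choose v with v_t^(Q+1) = u_t/a_t. In the basis of monomials, the form
  \<open>\<langle>c(x^i), c(x^j)\<rangle>\<^sub>l\<close> on the first n coordinates is then the moment
  of order d = i + Qj of the weights u_t/a_t, which by Lagrange interpolation is 0 for 0 < d < n,
  1 for d = n, and nonzero for d = 0. Row 0 forces f_0 = 0, and
  the rows m - Qt with 1 <= t <= \<open>\<xi>\<close> form a triangular system that kills the coefficients of
  index above m. The matrix A only affects indices at least k - s; the identity matrix with the
  single column of index m - (k - s) modified makes the Gram matrix an identity on the indices
  from k - s to m - 1 and annihilates its column m. The hull is therefore spanned by the codewords
  of x, ..., x^(k-s-1) and x^m.\<close>

subsection \<open>Finite fields\<close>

text \<open>Multiplication by \<open>x\<close> permutes \<open>S\<close>, so the product of all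
  elements of \<open>S\<close> absorbs the factor \<open>x ^ card S\<close>; that product is nonzero
  and cancels. Both the multiplicative group of the field and that of the subfield \<open>K\<close>
  are handled this way.\<close>

lemma power_card_mult_closed_eq_1:
  fixes x :: "'a::field"
  assumes "finite S" "0 \<notin> S" "x \<noteq> 0" "\<And>y. y \<in> S \<Longrightarrow> x * y \<in> S"
  shows "x ^ card S = 1"
proof -
  have inj: "inj_on ((*) x) S"
    using assms(3) by (auto intro: inj_onI)
  have "(*) x ` S = S"
    using assms(1,4) inj by (intro card_subset_eq) (auto simp: card_image)
  then have "\<Prod>S = (\<Prod>y\<in>S. x * y)"
    using inj by (metis (no_types, lifting) prod.reindex_cong)
  also have "\<dots> = x ^ card S * \<Prod>S"
    by (simp add: prod.distrib)
  finally show ?thesis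
    using assms(1,2) by (auto simp: prod_zero_iff)
qed

lemma card_power_eq_le:
  fixes c :: "'a::field"
  assumes "m > 0"
  shows "card {x. x ^ m = c} \<le> m"
proof -
  define P where "P = Polynomial.monom (1::'a) m - [:c:]"
  have "Polynomial.coeff P m = 1"
    using assms by (cases m) (auto simp: P_def)
  then have "P \<noteq> 0"
    by auto
  then have "card {x. poly P x = 0} \<le> Polynomial.degree P"
    by (rule card_poly_roots_bound)
  also have "Polynomial.degree P \<le> m"
    unfolding P_def by (intro Polynomial.degree_diff_le) (auto simp: Polynomial.degree_monom_eq)
  finally show ?thesis
    by (simp add: P_def poly_monom)
qed

lemma power_card_minus_1_eq_1:
  fixes x :: "'a::{field, finite}"
  assumes "x \<noteq> 0"
  shows "x ^ (card (UNIV :: 'a set) - 1) = 1"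
  using power_card_mult_closed_eq_1[of "UNIV - {0}" x] assms by (simp add: card_Diff_singleton)

text \<open>The m-th power map has fibres of size at most m, so its image on the nonzero elements
  has at least r elements; it consists of roots of y^r = 1, of which there are at most r.\<close>

lemma ex_power_eq:
  fixes c :: "'a::{field, finite}"
  assumes mr: "m * r = card (UNIV :: 'a set) - 1" and c: "c ^ r = 1"
  shows "\<exists>x. x ^ m = c"
proof -
  have "card {0, 1 :: 'a} \<le> card (UNIV :: 'a set)"
    by (intro card_mono) auto
  then have "m * r > 0"
    using mr by simp
  then have m: "m > 0" and r: "r > 0"
    by auto
  define F where "F = (UNIV :: 'a set) - {0}"
  define I where "I = (\<lambda>x. x ^ m) ` F"
  define R where "R = {y :: 'a. y ^ r = 1}"
  have "F = (\<Union>y\<in>I. {x \<in> F. x ^ m = y})"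
    by (auto simp: I_def)
  then have "card F = card (\<Union>y\<in>I. {x \<in> F. x ^ m = y})"
    by (rule arg_cong[where f = card])
  also have "\<dots> \<le> (\<Sum>y\<in>I. card {x \<in> F. x ^ m = y})"
    by (rule card_UN_le) simp
  also have "\<dots> \<le> (\<Sum>y\<in>I. m)"
  proof (rule sum_mono)
    fix y
    have "card {x \<in> F. x ^ m = y} \<le> card {x. x ^ m = y}"
      by (intro card_mono) auto
    then show "card {x \<in> F. x ^ m = y} \<le> m"
      using card_power_eq_le[OF m, of y] by linarith
  qed
  finally have "m * r \<le> card I * m"
    using mr by (simp add: F_def card_Diff_singleton)
  then have "r \<le> card I"
    using m by (simp add: mult.commute)
  moreover have "card R \<le> r"
    unfolding R_def by (rule card_power_eq_le[OF r])
  moreover have "I \<subseteq> R"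
    using power_card_minus_1_eq_1 by (auto simp: I_def R_def F_def mr simp flip: power_mult)
  ultimately have "I = R"
    by (intro card_subset_eq) (auto intro: antisym dest: card_mono[rotated])
  moreover have "c \<in> R"
    using c by (simp add: R_def)
  ultimately show ?thesis
    by (auto simp: I_def)
qed

lemma CHAR_eq_if_card_prime_power:
  assumes "Factorial_Ring.prime p" and "card (UNIV :: 'a::{field, finite} set) = p ^ e"
  shows "CHAR('a) = p"
proof -
  have "CHAR('a) > 0"
    by (rule finite_imp_CHAR_pos) simp
  then have "Factorial_Ring.prime CHAR('a)"
    by (rule prime_CHAR_semidom)
  moreover have "CHAR('a) dvd p ^ e"
    using CHAR_dvd_CARD[where 'a = 'a] assms(2) by simp
  ultimately show ?thesis
    using assms(1) by (meson prime_dvd_power primes_dvd_imp_eq)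
qed

text \<open>Additivity of the iterated Frobenius map; it expands the second argument of the Galois
  inner product in the coefficients of a polynomial.\<close>

lemma sum_power_prime_power:
  fixes f :: "'b \<Rightarrow> 'a::{field, finite}"
  assumes "Factorial_Ring.prime p" and "card (UNIV :: 'a set) = p ^ e"
  shows "(\<Sum>i\<in>A. f i) ^ (p ^ l) = (\<Sum>i\<in>A. f i ^ (p ^ l))"
  using freshmans_dream_sum'[of "p ^ l" l f A] CHAR_eq_if_card_prime_power[OF assms] assms(1) by simp

text \<open>Surjectivity of the norm in disguise: since 2l divides e, the product of
  \<open>p ^ l + 1\<close> and \<open>p ^ l - 1\<close> divides q - 1, so an element killed by the
  exponent \<open>p ^ l - 1\<close> is also killed by the cofactor of \<open>p ^ l + 1\<close> in q
  - 1.\<close>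

lemma ex_norm_eq:
  fixes c :: "'a::{field, finite}"
  assumes p: "p > 0" and card: "card (UNIV :: 'a set) = p ^ e" and e: "2 * l dvd e" and c: "c ^ (p ^ l - 1) = 1"
  shows "\<exists>x. x ^ (p ^ l + 1) = c"
proof -
  obtain t where t: "e = 2 * l * t"
    using e by (auto elim: dvdE)
  have "p ^ e = ((p ^ l)\<^sup>2) ^ t"
    unfolding t by (metis mult.commute power_mult)
  \<comment> \<open>Over the integers, x - 1 divides x^t - 1 for x = p^(2l), and x - 1 factors as a
    difference of squares without truncated subtraction.\<close>
  then have "int (p ^ e) - 1 = ((int p ^ l)\<^sup>2) ^ t - 1"
    by simp
  also have "(int p ^ l)\<^sup>2 - 1 dvd \<dots>"
    by (rule dvdI[OF power_diff_1_eq])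
  finally have "(int p ^ l + 1) * (int p ^ l - 1) dvd int (p ^ e) - 1"
    by (simp add: power2_eq_square algebra_simps)
  moreover have "p ^ e \<ge> 1" "p ^ l \<ge> 1"
    using p by simp_all
  then have "int ((p ^ l + 1) * (p ^ l - 1)) = (int p ^ l + 1) * (int p ^ l - 1)"
    and "int (p ^ e - 1) = int (p ^ e) - 1"
    by (simp_all only: of_nat_mult of_nat_add of_nat_diff of_nat_power of_nat_1)
  ultimately have "int ((p ^ l + 1) * (p ^ l - 1)) dvd int (p ^ e - 1)"
    by simp
  then have "(p ^ l + 1) * (p ^ l - 1) dvd p ^ e - 1"
    by (simp only: of_nat_dvd_iff)
  then obtain z where z: "p ^ e - 1 = (p ^ l + 1) * (p ^ l - 1) * z"
    by (auto elim: dvdE)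
  show ?thesis
  proof (rule ex_power_eq)
    show "(p ^ l + 1) * ((p ^ l - 1) * z) = card (UNIV :: 'a set) - 1"
      by (simp only: z card mult.assoc)
    show "c ^ ((p ^ l - 1) * z) = 1"
      by (simp only: c power_mult power_one)
  qed
qed

lemma subfield_class_ring_closed:
  fixes K :: "'a::field set"
  assumes "subfield K class_ring"
  shows "0 \<in> K" "1 \<in> K" "x \<in> K \<Longrightarrow> - x \<in> K" "x \<in> K \<Longrightarrow> y \<in> K \<Longrightarrow> x * y \<in> K"
  using subringE[OF subfieldE(1)[OF assms]] by (auto simp: class_ring_simps)

lemma subfield_power_card_minus_1_eq_1:
  fixes K :: "'a::{field, finite} set"
  assumes K: "subfield K class_ring" and x: "x \<in> K - {0}"
  shows "x ^ (card K - 1) = 1"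
proof -
  have "card (K - {0}) = card K - 1"
    using subfield_class_ring_closed(1)[OF K] by simp
  moreover have "x ^ card (K - {0}) = 1"
    using x subfield_class_ring_closed(4)[OF K] by (intro power_card_mult_closed_eq_1) auto
  ultimately show ?thesis
    by simp
qed

subsection \<open>Lagrange weights\<close>

text \<open>Compare the coefficients of degree \<open>n - 1\<close> in the Lagrange interpolation
  formula: each \<open>L j\<close> is monic of that degree, and \<open>w j\<close> normalizes it to
  the value 1 at \<open>x j\<close>.\<close>

lemma sum_poly_lagrange_weights:
  fixes x :: "nat \<Rightarrow> 'a::field"
  assumes inj: "inj_on x {..<n}" and deg: "Polynomial.degree P < n"
  shows "(\<Sum>j<n. poly P (x j) * (\<Prod>i\<in>{..<n} - {j}. inverse (x j - x i))) = Polynomial.coeff P (n - 1)"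
proof -
  define L where "L = (\<lambda>j. \<Prod>i\<in>{..<n} - {j}. [:- x i, 1:])"
  define w where "w = (\<lambda>j. \<Prod>i\<in>{..<n} - {j}. inverse (x j - x i))"
  have degL: "Polynomial.degree (L j) = n - 1" if "j < n" for j
    using that unfolding L_def by (subst degree_prod_eq_sum_degree) auto
  have lcL: "lead_coeff (L j) = 1" for j
    unfolding L_def lead_coeff_prod by (rule prod.neutral) simp
  have cL: "Polynomial.coeff (L j) (n - 1) = 1" if "j < n" for j
    using lcL[of j] by (simp only: degL[OF that])
  have Lx: "w j * poly (L j) (x t) = (if t = j then 1 else 0)" if "j < n" "t < n" for j t
  proof (cases "t = j")
    case True
    have "x j - x i \<noteq> 0" if "i \<in> {..<n} - {j}" for i
      using inj that \<open>j < n\<close> by (auto dest: inj_onD)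
    then show ?thesis
      using True by (simp add: w_def L_def poly_prod flip: prod.distrib)
  next
    case False
    then have "poly (L j) (x t) = 0"
      using that by (auto simp: L_def poly_prod intro!: prod_zero bexI[of _ t])
    with False show ?thesis
      by simp
  qed
  have "P = (\<Sum>j<n. Polynomial.smult (poly P (x j) * w j) (L j))"
  proof (rule poly_eqI_degree[where A = "x ` {..<n}"])
    have c: "card (x ` {..<n}) = n"
      using inj by (simp add: card_image)
    show "Polynomial.degree P < card (x ` {..<n})"
      using deg c by simp
    have "Polynomial.degree (\<Sum>j<n. Polynomial.smult (poly P (x j) * w j) (L j)) \<le> n - 1"
      by (intro degree_sum_le) (auto intro: order_trans[OF degree_smult_le] simp: degL)
    then show "Polynomial.degree (\<Sum>j<n. Polynomial.smult (poly P (x j) * w j) (L j)) < card (x ` {..<n})"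
      using deg c by simp
    fix y assume "y \<in> x ` {..<n}"
    then obtain t where t: "t < n" "y = x t"
      by auto
    have "poly (\<Sum>j<n. Polynomial.smult (poly P (x j) * w j) (L j)) y
        = (\<Sum>j<n. poly P (x j) * (w j * poly (L j) (x t)))"
      by (simp add: poly_sum t(2) mult.assoc)
    also have "\<dots> = (\<Sum>j<n. if j = t then poly P (x j) else 0)"
      using t by (intro sum.cong) (auto simp: Lx)
    finally show "poly P y = poly (\<Sum>j<n. Polynomial.smult (poly P (x j) * w j) (L j)) y"
      using t by simp
  qed
  then have "Polynomial.coeff P (n - 1)
      = Polynomial.coeff (\<Sum>j<n. Polynomial.smult (poly P (x j) * w j) (L j)) (n - 1)"
    by (rule arg_cong)
  also have "\<dots> = (\<Sum>j<n. poly P (x j) * w j * Polynomial.coeff (L j) (n - 1))"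
    by (simp add: coeff_sum)
  also have "\<dots> = (\<Sum>j<n. poly P (x j) * w j)"
    by (intro sum.cong refl) (simp only: cL lessThan_iff mult_1_right)
  finally show ?thesis
    by (simp add: w_def)
qed

text \<open>Write the product of all X - x_i as c + X R. At each node 1/x_j = -R(x_j)/c, and R is
  monic of degree \<open>n - 1\<close>, so the sum is -1/c by the previous lemma. This is the moment
  of order 0.\<close>

lemma sum_inverse_lagrange_weights_nonzero:
  fixes x :: "nat \<Rightarrow> 'a::field"
  assumes inj: "inj_on x {..<n}" and nz: "\<And>j. j < n \<Longrightarrow> x j \<noteq> 0" and n: "n > 0"
  shows "(\<Sum>j<n. inverse (x j) * (\<Prod>i\<in>{..<n} - {j}. inverse (x j - x i))) \<noteq> 0"
proof -
  define W where "W = (\<Prod>i<n. [:- x i, 1:])"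
  obtain c R where W: "W = pCons c R"
    by (cases W)
  have "Polynomial.degree W = n"
    unfolding W_def by (subst degree_prod_eq_sum_degree) auto
  moreover have "lead_coeff W = 1"
    unfolding W_def lead_coeff_prod by (rule prod.neutral) simp
  ultimately have R: "Polynomial.degree R = n - 1" "Polynomial.coeff R (n - 1) = 1"
    using n by (auto simp: W degree_pCons_eq_if coeff_pCons split: if_splits nat.splits)
  have "c = poly W 0"
    by (simp add: W)
  then have c: "c \<noteq> 0"
    using nz by (auto simp: W_def poly_prod prod_zero_iff)
  have inv: "inverse (x j) = - inverse c * poly R (x j)" if "j < n" for j
  proof -
    have "poly W (x j) = 0"
      using that by (auto simp: W_def poly_prod intro!: prod_zero bexI[of _ j])
    then have "c + x j * poly R (x j) = 0"
      by (simp add: W)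
    then have "c = - (x j * poly R (x j))"
      by (rule eq_neg_iff_add_eq_0[THEN iffD2])
    then show ?thesis
      using c nz[OF that] by (simp add: field_simps)
  qed
  have "(\<Sum>j<n. inverse (x j) * (\<Prod>i\<in>{..<n} - {j}. inverse (x j - x i)))
      = - inverse c * (\<Sum>j<n. poly R (x j) * (\<Prod>i\<in>{..<n} - {j}. inverse (x j - x i)))"
    unfolding sum_distrib_left by (intro sum.cong refl) (simp add: inv mult.assoc)
  also have "\<dots> = - inverse c"
    using sum_poly_lagrange_weights[OF inj, of R] R n by simp
  finally show ?thesis
    using c by simp
qed

subsection \<open>Linear algebra\<close>

text \<open>Rank-nullity with trivial kernel.\<close>

lemma linear_code_injective_image:
  fixes T :: "'a::field vec \<Rightarrow> 'a vec"
  assumes carr: "\<And>x. x \<in> carrier_vec d \<Longrightarrow> T x \<in> carrier_vec N"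
    and add: "\<And>x y. x \<in> carrier_vec d \<Longrightarrow> y \<in> carrier_vec d \<Longrightarrow> T (x + y) = T x + T y"
    and smult: "\<And>c x. x \<in> carrier_vec d \<Longrightarrow> T (c \<cdot>\<^sub>v x) = c \<cdot>\<^sub>v T x"
    and inj: "inj_on T (carrier_vec d)"
  shows "linear_code N d (T ` carrier_vec d)"
proof -
  interpret D: vec_space "TYPE('a)" d .
  interpret E: vec_space "TYPE('a)" N .
  interpret linear_map class_ring "module_vec TYPE('a) d" "module_vec TYPE('a) N" T
    by (intro linear_map.intro mod_hom.intro mod_hom_axioms.intro vec_vs vec_module)
      (auto simp: LinearCombinations.module_hom_def module_vec_simps carr add smult)
  have im: "T ` carrier_vec d = im"
    by (simp only: im_def module_vec_simps)
  have "inj_on T (carrier (module_vec TYPE('a) d))"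
    using inj by (simp only: module_vec_simps)
  from rank_nullity[OF D.fin_dim] inj_imp_dim_ker0[OF this]
  have "vectorspace.dim class_ring (E.vs im) = d"
    by (simp only: D.dim_is_n add_0_right)
  then show ?thesis
    unfolding linear_code_def code_dim_def im using imT_is_subspace by (intro conjI)
qed

lemma invertible_mat_lower_triangular:
  fixes A :: "'a::field mat"
  assumes A: "A \<in> carrier_mat s s"
    and tri: "\<And>i j. i < j \<Longrightarrow> j < s \<Longrightarrow> A $$ (i, j) = 0"
    and diag: "\<And>i. i < s \<Longrightarrow> A $$ (i, i) \<noteq> 0"
  shows "invertible_mat A"
proof -
  have "det A = (\<Prod>i = 0..<s. A $$ (i, i))"
    using det_lower_triangular[OF tri A] prod_list_diag_prod[of A] A by auto
  then have "det A \<noteq> 0"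
    using diag by simp
  then obtain B where "B \<in> carrier_mat s s" "A * B = 1\<^sub>m s" "B * A = 1\<^sub>m s"
    using det_non_zero_imp_unit[OF A] by (auto simp: Units_def ring_mat_def)
  then show ?thesis
    using A unfolding invertible_mat_def inverts_mat_def by auto
qed

text \<open>The index argument, separated from the code: \<open>G\<close> is the Gram matrix and
  \<open>y j\<close> stands for the Q-th power of the coefficient of x^j, which makes the system
  linear. Each unknown to be killed gets a row in which it alone survives, in the order 0, then
  indices above \<open>m\<close> downwards, then \<open>k - s\<close> to
  \<open>m - 1\<close>.\<close>

lemma hull_system_iff:
  fixes G :: "nat \<Rightarrow> nat \<Rightarrow> 'a::field"
  assumes k: "k = \<xi> + 1 + m" and s: "\<xi> + 1 \<le> s" "s \<le> \<xi> + Q" "s < k"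
    and \<xi>: "\<xi> < Q" "Q * \<xi> < m"
    and G_0_0: "G 0 0 \<noteq> 0"
    and G_low: "\<And>i j. i < k - s \<Longrightarrow> j < k \<Longrightarrow> 0 < i + Q * j \<Longrightarrow> i + Q * j < m * (Q + 1) \<Longrightarrow> G i j = 0"
    and G_one: "\<And>i j. i < k - s \<Longrightarrow> j < k \<Longrightarrow> i + Q * j = m * (Q + 1) \<Longrightarrow> G i j = 1"
    and G_left: "\<And>i j. k - s \<le> i \<Longrightarrow> i < k \<Longrightarrow> j < k - s \<Longrightarrow> G i j = 0"
    and G_block: "\<And>i j. k - s \<le> i \<Longrightarrow> i < k \<Longrightarrow> k - s \<le> j \<Longrightarrow> j < m \<Longrightarrow> G i j = (if i = j then 1 else 0)"
    and G_m: "\<And>i. i < k \<Longrightarrow> G i m = 0"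
  shows "(\<forall>i<k. (\<Sum>j<k. G i j * y j) = 0) \<longleftrightarrow> (\<forall>j<k. y j \<noteq> 0 \<longrightarrow> j \<in> insert m {1..<k - s})"
    (is "?kernel \<longleftrightarrow> ?supp")
proof
  have single: "(\<Sum>j<k. G i j * y j) = G i t * y t"
    if "t < k" "\<And>j. j < k \<Longrightarrow> j \<noteq> t \<Longrightarrow> G i j * y j = 0" for i t
  proof -
    have "(\<Sum>j\<in>{..<k} - {t}. G i j * y j) = 0"
      using that(2) by (intro sum.neutral ballI) simp
    then show ?thesis
      using that(1) by (subst sum.remove[of _ t]) simp_all
  qed
  have ks: "0 < k - s" "k - s \<le> m"
    using k s by auto
  assume kernel: ?kernel
  \<comment> \<open>In row 0 the largest order is Q(\<xi> + m), which stays below m(Q + 1) because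
    Q\<xi> < m; hence only column 0 is left.\<close>
  have y_0: "y 0 = 0"
  proof -
    have "G 0 j * y j = 0" if "j < k" "j \<noteq> 0" for j
    proof -
      have "Q * j \<le> Q * (\<xi> + m)"
        using that k by simp
      also have "\<dots> < m * (Q + 1)"
        using \<xi> by (simp add: algebra_simps)
      finally show ?thesis
        using that ks \<xi> by (subst G_low) auto
    qed
    then have "G 0 0 * y 0 = 0"
      using kernel single[of 0 0] k by simp
    then show ?thesis
      using G_0_0 by simp
  qed
  have y_high: "y (m + t) = 0" if "1 \<le> t" "t \<le> \<xi>" for t
    using that
  proof (induction "\<xi> - t" arbitrary: t rule: less_induct)
    case less
    \<comment> \<open>Chosen so that column \<open>m + t\<close> has order exactly
      \<open>m * (Q + 1)\<close>. Columns to the left have smaller positive order, and those to the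
      right are covered by induction. The row is positive by Q\<xi> < m and lies below
      \<open>k - s\<close> by s \<le> \<xi> + Q.\<close>
    define i where "i = m - Q * t"
    have "Q * t \<le> Q * \<xi>" "Q \<le> Q * t"
      using less.prems by auto
    then have i: "i + Q * t = m" "0 < i" "i \<le> m - Q" "Q < m"
      using \<xi>(2) unfolding i_def by linarith+
    have i_less: "i < k - s"
      using i k s by linarith
    have "G i j * y j = 0" if j: "j < k" "j \<noteq> m + t" for j
    proof (cases "j < m + t")
      case True
      then have "Q * j \<le> Q * (m + t - 1)"
        by (intro mult_le_mono2) linarith
      also have "\<dots> = Q * m + Q * t - Q"
        by (simp add: algebra_simps)
      finally have "i + Q * j \<le> i + Q * m + Q * t - Q"
        using \<open>Q \<le> Q * t\<close> by linarith
      also have "\<dots> = m + Q * m - Q"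
        using i by simp
      also have "\<dots> < m * (Q + 1)"
        using \<xi> i by (simp add: mult.commute)
      finally show ?thesis
        using G_low[OF i_less j(1)] i by simp
    next
      case False
      then have "y (m + (j - m)) = 0"
        using j k less.prems by (intro less.hyps) auto
      then show ?thesis
        using False j by simp
    qed
    then have "G i (m + t) * y (m + t) = 0"
      using kernel single[of "m + t" i] less.prems k i_less by simp
    moreover have "G i (m + t) = 1"
      using i less.prems k by (intro G_one i_less) (auto simp: algebra_simps)
    ultimately show ?case
      by simp
  qed
  \<comment> \<open>Row \<open>i\<close> itself is used: the unknowns above \<open>m\<close> are
    already zero, and column \<open>m\<close> and the columns below \<open>k - s\<close> vanish in
    this row.\<close>
  have y_mid: "y i = 0" if i: "k - s \<le> i" "i < m" for i
  proof -
    have "G i j * y j = 0" if j: "j < k" "j \<noteq> i" for j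
    proof -
      consider "j < k - s" | "k - s \<le> j" "j < m" | "j = m" | "m < j"
        by linarith
      then show ?thesis
      proof cases
        case 4
        then show ?thesis
          using y_high[of "j - m"] j k by simp
      qed (use i j k G_left G_block G_m in auto)
    qed
    then show ?thesis
      using kernel single[of i i] i k G_block[of i i] by simp
  qed
  show ?supp
  proof (intro allI impI)
    fix j assume j: "j < k" "y j \<noteq> 0"
    have "j \<noteq> 0"
      using j y_0 by metis
    moreover have "\<not> (k - s \<le> j \<and> j < m)"
      using j y_mid by blast
    moreover have "\<not> m < j"
    proof
      assume "m < j"
      then have "y (m + (j - m)) = 0"
        using j(1) k by (intro y_high) linarith+
      then show False
        using \<open>m < j\<close> j(2) by simp
    qed
    ultimately show "j \<in> insert m {1..<k - s}"
      by auto
  qed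
next
  assume supp: ?supp
  \<comment> \<open>Conversely every single term vanishes: column \<open>m\<close> is zero, and a
    column from 1 to \<open>k - s - 1\<close> meets only orders strictly between 0 and
    \<open>m * (Q + 1)\<close> in the rows below \<open>k - s\<close>.\<close>
  have "G i j * y j = 0" if i: "i < k" and j: "j < k" for i j
  proof -
    consider "y j = 0" | "j = m" | "1 \<le> j" "j < k - s"
      using supp j by auto
    then show ?thesis
    proof cases
      case 3
      show ?thesis
      proof (cases "i < k - s")
        case True
        have "j \<le> m - 1"
          using 3 k s by simp
        then have "Q * j \<le> Q * (m - 1)"
          by (rule mult_le_mono2)
        also have "\<dots> = Q * m - Q"
          by (simp add: algebra_simps)
        finally have "Q * j \<le> Q * m - Q" .
        moreover have "Q \<le> Q * m"
          using \<xi> by simp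
        moreover have "i < m"
          using True k s by simp
        ultimately have "i + Q * j < m * (Q + 1)"
          by (simp add: mult.commute)
        then show ?thesis
          using G_low[OF True j] 3 \<xi> by simp
      qed (use 3 i G_left in auto)
    qed (use i G_m in auto)
  qed
  then show ?kernel
    by (auto intro: sum.neutral)
qed

subsection \<open>Generalized Roth-Lempel codes\<close>

definition grl_word :: "nat \<Rightarrow> nat \<Rightarrow> nat \<Rightarrow> 'a::field vec \<Rightarrow> 'a vec \<Rightarrow> 'a mat \<Rightarrow> 'a poly \<Rightarrow> 'a vec" where
  "grl_word n k s a v A f =
     vec n (\<lambda>i. v $ i * poly f (a $ i)) @\<^sub>v
       (transpose_mat A *\<^sub>v vec s (\<lambda>j. Polynomial.coeff f (k - s + j)))"

text \<open>Row i of the generator matrix, that is, the codeword of x^i.\<close>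

definition grl_gen :: "nat \<Rightarrow> nat \<Rightarrow> nat \<Rightarrow> 'a::field vec \<Rightarrow> 'a vec \<Rightarrow> 'a mat \<Rightarrow> nat \<Rightarrow> nat \<Rightarrow> 'a" where
  "grl_gen n k s a v A i c =
     (if c < n then v $ c * (a $ c) ^ i
      else if k - s \<le> i then A $$ (i - (k - s), c - n) else 0)"

lemma GRL_code_eq: "GRL_code n k s a v A = grl_word n k s a v A ` {f. Polynomial.degree f < k}"
  by (auto simp: GRL_code_def grl_word_def)

lemma grl_word_carrier:
  assumes "A \<in> carrier_mat s s"
  shows "grl_word n k s a v A f \<in> carrier_vec (n + s)"
  using assms by (auto simp: grl_word_def)

lemma poly_eq_sum_lessThan:
  fixes x :: "'a::field"
  assumes "Polynomial.degree f < k"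
  shows "poly f x = (\<Sum>i<k. Polynomial.coeff f i * x ^ i)"
proof -
  have "poly f x = (\<Sum>i\<le>Polynomial.degree f. Polynomial.coeff f i * x ^ i)"
    by (rule poly_altdef)
  also have "\<dots> = (\<Sum>i<k. Polynomial.coeff f i * x ^ i)"
    using assms by (intro sum.mono_neutral_left) (auto simp: coeff_eq_0)
  finally show ?thesis .
qed

lemma grl_word_index:
  assumes A: "A \<in> carrier_mat s s" and s: "s \<le> k" and f: "Polynomial.degree f < k" and c: "c < n + s"
  shows "grl_word n k s a v A f $ c = (\<Sum>i<k. Polynomial.coeff f i * grl_gen n k s a v A i c)"
proof (cases "c < n")
  case True
  then show ?thesis
    using A by (simp add: grl_word_def grl_gen_def poly_eq_sum_lessThan[OF f] sum_distrib_left mult_ac)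
next
  case False
  then have "grl_word n k s a v A f $ c = (\<Sum>j<s. A $$ (j, c - n) * Polynomial.coeff f (k - s + j))"
    using A c by (simp add: grl_word_def scalar_prod_def lessThan_atLeast0)
  also have "\<dots> = (\<Sum>i\<in>{k - s..<k}. A $$ (i - (k - s), c - n) * Polynomial.coeff f i)"
    using s by (intro sum.reindex_bij_witness[of _ "\<lambda>i. i - (k - s)" "\<lambda>j. k - s + j"]) auto
  also have "\<dots> = (\<Sum>i\<in>{k - s..<k}. Polynomial.coeff f i * grl_gen n k s a v A i c)"
    using False by (simp add: grl_gen_def mult.commute)
  also have "\<dots> = (\<Sum>i<k. Polynomial.coeff f i * grl_gen n k s a v A i c)"
    using False by (intro sum.mono_neutral_left) (auto simp: grl_gen_def)
  finally show ?thesis .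
qed

text \<open>The form is linear in \<open>g\<close> and, by additivity of the Frobenius map,
  semilinear in \<open>f\<close>; the inner sum over \<open>c\<close> is the Gram matrix of the
  generator rows.\<close>

lemma galois_inner_grl_word:
  fixes a v :: "'a::field vec"
  assumes frob: "\<And>x :: nat \<Rightarrow> 'a. \<And>I. (\<Sum>i\<in>I. x i) ^ (p ^ l) = (\<Sum>i\<in>I. x i ^ (p ^ l))"
    and A: "A \<in> carrier_mat s s" and s: "s \<le> k"
    and f: "Polynomial.degree f < k" and g: "Polynomial.degree g < k"
  shows "galois_inner p l (grl_word n k s a v A g) (grl_word n k s a v A f) =
    (\<Sum>i<k. Polynomial.coeff g i * (\<Sum>j<k.
       (\<Sum>c<n + s. grl_gen n k s a v A i c * grl_gen n k s a v A j c ^ (p ^ l)) * Polynomial.coeff f j ^ (p ^ l)))"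
proof -
  let ?E = "grl_gen n k s a v A"
  have "dim_vec (grl_word n k s a v A g) = n + s"
    using grl_word_carrier[OF A] by (rule carrier_vecD)
  then have "galois_inner p l (grl_word n k s a v A g) (grl_word n k s a v A f) =
    (\<Sum>c<n + s. (\<Sum>i<k. Polynomial.coeff g i * ?E i c) * (\<Sum>j<k. Polynomial.coeff f j * ?E j c) ^ (p ^ l))"
    unfolding galois_inner_def by (intro sum.cong) (auto simp: grl_word_index[OF A s f] grl_word_index[OF A s g])
  also have "\<dots> = (\<Sum>c<n + s. \<Sum>i<k. \<Sum>j<k. Polynomial.coeff g i * (?E i c * ?E j c ^ (p ^ l) * Polynomial.coeff f j ^ (p ^ l)))"
    by (simp add: frob sum_product power_mult_distrib mult_ac)
  also have "\<dots> = (\<Sum>i<k. \<Sum>j<k. \<Sum>c<n + s. Polynomial.coeff g i * (?E i c * ?E j c ^ (p ^ l) * Polynomial.coeff f j ^ (p ^ l)))"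
    by (rule trans[OF sum.swap], rule sum.cong[OF refl], rule sum.swap)
  finally show ?thesis
    by (simp add: sum_distrib_left sum_distrib_right)
qed

text \<open>The first \<open>n\<close> coordinates already determine the polynomial, since its
  degree is below k \<le> n and the multipliers are nonzero.\<close>

lemma inj_on_grl_word:
  assumes P: "GRL_params n k s a v A"
  shows "inj_on (grl_word n k s a v A) {f. Polynomial.degree f < k}"
proof (intro inj_onI, clarify)
  have A: "A \<in> carrier_mat s s" and kn: "k \<le> n" and v: "\<And>i. i < n \<Longrightarrow> v $ i \<noteq> 0"
    and a: "inj_on (($) a) {..<n}"
    using P by (auto simp: GRL_params_def inj_on_def)
  fix f g assume fg: "Polynomial.degree f < k" "Polynomial.degree g < k"
    and eq: "grl_word n k s a v A f = grl_word n k s a v A g"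
  have card: "card (($) a ` {..<n}) = n"
    using a by (simp add: card_image)
  have "poly f (a $ i) = poly g (a $ i)" if "i < n" for i
  proof -
    have "grl_word n k s a v A f $ i = grl_word n k s a v A g $ i"
      by (simp only: eq)
    then show ?thesis
      using that v A by (simp add: grl_word_def)
  qed
  then have "poly f x = poly g x" if "x \<in> ($) a ` {..<n}" for x
    using that by blast
  then show "f = g"
    by (rule poly_eqI_degree[where A = "($) a ` {..<n}"]) (use fg kn card in linarith)+
qed

text \<open>An enumeration \<open>h\<close> of \<open>J\<close> identifies the polynomials supported
  on \<open>J\<close> with vectors of length \<open>card J\<close>. The lemma serves twice: for the
  code, with all indices below \<open>k\<close>, and for its hull.\<close>

lemma linear_code_grl_word_supported:
  fixes a v :: "'a::field vec"
  assumes P: "GRL_params n k s a v A" and J: "J \<subseteq> {..<k}"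
  shows "linear_code (n + s) (card J)
    (grl_word n k s a v A ` {f. \<forall>j. Polynomial.coeff f j \<noteq> 0 \<longrightarrow> j \<in> J})"
proof -
  have A: "A \<in> carrier_mat s s" and s: "s \<le> k" and k: "0 < k"
    using P by (auto simp: GRL_params_def)
  let ?W = "grl_word n k s a v A" and ?d = "card J"
  have "finite J"
    by (rule finite_subset[OF J]) simp
  then obtain h where h: "bij_betw h {0..<?d} J"
    using ex_bij_betw_nat_finite by blast
  define F where "F x = (\<Sum>i<?d. Polynomial.monom (x $ i) (h i))" for x :: "'a vec"
  have hJ: "h i \<in> J" if "i < ?d" for i
    using h that by (auto simp: bij_betw_def)
  have h_eq: "h i = h j \<longleftrightarrow> i = j" if "i < ?d" "j < ?d" for i j
    using h that by (auto simp: bij_betw_def inj_on_def)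
  have coeff_h: "Polynomial.coeff (F x) (h j) = x $ j" if "j < ?d" for x j
  proof -
    have "Polynomial.coeff (F x) (h j) = (\<Sum>i<?d. if i = j then x $ i else 0)"
      unfolding F_def using that by (auto simp: coeff_sum h_eq intro!: sum.cong)
    then show ?thesis
      using that by simp
  qed
  have coeff_not: "Polynomial.coeff (F x) j = 0" if "j \<notin> J" for x j
    using that hJ by (auto simp: F_def coeff_sum intro!: sum.neutral)
  have deg: "Polynomial.degree f < k" if "\<forall>j. Polynomial.coeff f j \<noteq> 0 \<longrightarrow> j \<in> J" for f :: "'a poly"
    using that J k by (cases "f = 0") (auto dest!: spec[of _ "Polynomial.degree f"])
  have degF: "Polynomial.degree (F x) < k" for x
    using deg coeff_not by blast
  have F_add: "F (x + y) = F x + F y" if "x \<in> carrier_vec ?d" "y \<in> carrier_vec ?d" for x y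
    using that by (simp add: F_def add_monom flip: sum.distrib)
  have F_smult: "F (c \<cdot>\<^sub>v x) = Polynomial.smult c (F x)" if "x \<in> carrier_vec ?d" for c x
    using that by (intro poly_eqI) (simp add: F_def coeff_sum sum_distrib_left if_distrib cong: if_cong)
  have W_add: "?W (f + g) = ?W f + ?W g" if "Polynomial.degree f < k" "Polynomial.degree g < k" for f g
  proof (rule eq_vecI)
    fix c assume "c < dim_vec (?W f + ?W g)"
    then have "c < n + s"
      using grl_word_carrier[OF A, of n k a v g] by simp
    moreover have "Polynomial.degree (f + g) < k"
      using that by (rule degree_add_less)
    ultimately show "?W (f + g) $ c = (?W f + ?W g) $ c"
      using that carrier_vecD[OF grl_word_carrier[OF A, of n k a v g]]
      by (simp add: grl_word_index[OF A s] sum.distrib algebra_simps)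
  qed (simp add: carrier_vecD[OF grl_word_carrier[OF A]])
  have W_smult: "?W (Polynomial.smult c f) = c \<cdot>\<^sub>v ?W f" if "Polynomial.degree f < k" for c f
  proof (rule eq_vecI)
    fix i assume "i < dim_vec (c \<cdot>\<^sub>v ?W f)"
    then have i: "i < n + s"
      using grl_word_carrier[OF A, of n k a v f] by simp
    moreover have "Polynomial.degree (Polynomial.smult c f) < k"
      using that degree_smult_le[of c f] by linarith
    ultimately show "?W (Polynomial.smult c f) $ i = (c \<cdot>\<^sub>v ?W f) $ i"
      using that carrier_vecD[OF grl_word_carrier[OF A, of n k a v f]]
      by (simp add: grl_word_index[OF A s] sum_distrib_left mult_ac)
  qed (simp add: carrier_vecD[OF grl_word_carrier[OF A]])
  have "linear_code (n + s) ?d ((\<lambda>x. ?W (F x)) ` carrier_vec ?d)"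
  proof (rule linear_code_injective_image)
    show "inj_on (\<lambda>x. ?W (F x)) (carrier_vec ?d)"
    proof (rule inj_onI)
      fix x y assume xy: "x \<in> carrier_vec ?d" "y \<in> carrier_vec ?d" "?W (F x) = ?W (F y)"
      have "F x = F y"
        using xy(3) by (rule inj_onD[OF inj_on_grl_word[OF P]]) (simp_all add: degF)
      then have eq: "x $ i = y $ i" if "i < ?d" for i
        using coeff_h[OF that, of x] coeff_h[OF that, of y] by simp
      then show "x = y"
        using xy(1,2) by (intro eq_vecI) simp_all
    qed
  qed (simp_all add: grl_word_carrier[OF A] F_add F_smult W_add W_smult degF)
  moreover have "F ` carrier_vec ?d = {f. \<forall>j. Polynomial.coeff f j \<noteq> 0 \<longrightarrow> j \<in> J}"
  proof (intro equalityI subsetI)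
    fix f :: "'a poly" assume f: "f \<in> {f. \<forall>j. Polynomial.coeff f j \<noteq> 0 \<longrightarrow> j \<in> J}"
    define x where "x = vec ?d (\<lambda>i. Polynomial.coeff f (h i))"
    have "F x = f"
    proof (rule poly_eqI)
      fix j
      show "Polynomial.coeff (F x) j = Polynomial.coeff f j"
      proof (cases "j \<in> J")
        case True
        then obtain i where "i < ?d" "j = h i"
          using h by (metis atLeastLessThan_iff bij_betw_def imageE)
        then show ?thesis
          by (simp add: coeff_h) (simp add: x_def)
      next
        case False
        then show ?thesis
          using f coeff_not by auto
      qed
    qed
    moreover have "x \<in> carrier_vec ?d"
      by (simp add: x_def)
    ultimately show "f \<in> F ` carrier_vec ?d"
      by blast
  qed (use coeff_not in blast)
  ultimately show ?thesis
    by (simp add: image_image[symmetric])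
qed

lemma sum_lessThan_add:
  fixes f :: "nat \<Rightarrow> 'a::comm_monoid_add"
  shows "(\<Sum>c<n + s. f c) = (\<Sum>c<n. f c) + (\<Sum>c<s. f (n + c))"
  by (induction s) (auto simp: add.assoc)

text \<open>The first \<open>n\<close> coordinates contribute a moment that depends on
  \<open>i + Q * j\<close> only; the last \<open>s\<close> contribute the form on the rows of
  \<open>A\<close>, and only for indices from \<open>k - s\<close> on.\<close>

lemma sum_grl_gen_mult:
  assumes "Q > 0"
  shows "(\<Sum>c<n + s. grl_gen n k s a v A i c * grl_gen n k s a v A j c ^ Q) =
    (\<Sum>t<n. v $ t ^ (Q + 1) * a $ t ^ (i + Q * j)) +
    (if k - s \<le> i \<and> k - s \<le> j then \<Sum>c<s. A $$ (i - (k - s), c) * A $$ (j - (k - s), c) ^ Q else 0)"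
proof -
  have "(\<Sum>c<n. grl_gen n k s a v A i c * grl_gen n k s a v A j c ^ Q)
      = (\<Sum>t<n. v $ t ^ (Q + 1) * a $ t ^ (i + Q * j))"
  proof (intro sum.cong refl)
    fix t assume "t \<in> {..<n}"
    moreover have "a $ t ^ (Q * j) = (a $ t ^ j) ^ Q"
      by (metis mult.commute power_mult)
    ultimately show "grl_gen n k s a v A i t * grl_gen n k s a v A j t ^ Q = v $ t ^ (Q + 1) * a $ t ^ (i + Q * j)"
      by (simp add: grl_gen_def power_mult_distrib power_add mult_ac)
  qed
  moreover have "(\<Sum>c<s. grl_gen n k s a v A i (n + c) * grl_gen n k s a v A j (n + c) ^ Q)
      = (if k - s \<le> i \<and> k - s \<le> j then \<Sum>c<s. A $$ (i - (k - s), c) * A $$ (j - (k - s), c) ^ Q else 0)"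
    using assms by (simp add: grl_gen_def)
  ultimately show ?thesis
    by (simp only: sum_lessThan_add)
qed

text \<open>Positivity of \<open>k\<close> takes care of the zero polynomial, whose degree is 0 by
  convention.\<close>

lemma degree_less_supported_iff:
  fixes f :: "'a::zero poly"
  assumes J: "J \<subseteq> {..<k}" and k: "0 < k"
  shows "Polynomial.degree f < k \<and> (\<forall>j<k. Polynomial.coeff f j \<noteq> 0 \<longrightarrow> j \<in> J)
    \<longleftrightarrow> (\<forall>j. Polynomial.coeff f j \<noteq> 0 \<longrightarrow> j \<in> J)"
proof
  assume *: "\<forall>j. Polynomial.coeff f j \<noteq> 0 \<longrightarrow> j \<in> J"
  then have "f \<noteq> 0 \<Longrightarrow> Polynomial.degree f \<in> J"
    by simp
  then have "Polynomial.degree f < k"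
    using J k by (cases "f = 0") auto
  with * show "Polynomial.degree f < k \<and> (\<forall>j<k. Polynomial.coeff f j \<noteq> 0 \<longrightarrow> j \<in> J)"
    by simp
next
  assume *: "Polynomial.degree f < k \<and> (\<forall>j<k. Polynomial.coeff f j \<noteq> 0 \<longrightarrow> j \<in> J)"
  show "\<forall>j. Polynomial.coeff f j \<noteq> 0 \<longrightarrow> j \<in> J"
  proof (intro allI impI)
    fix j assume "Polynomial.coeff f j \<noteq> 0"
    then show "j \<in> J"
      using * le_degree[of f j] by simp
  qed
qed

text \<open>A codeword lies in the dual iff it is orthogonal to every generator row, that is, iff
  the Q-th powers of its coefficients (Q = p^l) solve the Gram system.\<close>

lemma galois_hull_GRL_code:
  fixes a v :: "'a::field vec"
  assumes frob: "\<And>x :: nat \<Rightarrow> 'a. \<And>I. (\<Sum>i\<in>I. x i) ^ (p ^ l) = (\<Sum>i\<in>I. x i ^ (p ^ l))"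
    and p: "p > 0"
    and P: "GRL_params n k s a v A" and J: "J \<subseteq> {..<k}"
    and kernel: "\<And>y. (\<forall>i<k. (\<Sum>j<k.
        (\<Sum>c<n + s. grl_gen n k s a v A i c * grl_gen n k s a v A j c ^ (p ^ l)) * y j) = 0)
      \<longleftrightarrow> (\<forall>j<k. y j \<noteq> 0 \<longrightarrow> j \<in> J)"
  shows "galois_hull p l (n + s) (GRL_code n k s a v A) =
    grl_word n k s a v A ` {f. \<forall>j. Polynomial.coeff f j \<noteq> 0 \<longrightarrow> j \<in> J}"
proof -
  have A: "A \<in> carrier_mat s s" and s: "s \<le> k" and k: "0 < k"
    using P by (auto simp: GRL_params_def)
  let ?W = "grl_word n k s a v A"
  define row where "row f i = (\<Sum>j<k. (\<Sum>c<n + s. grl_gen n k s a v A i c * grl_gen n k s a v A j c ^ (p ^ l))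
    * Polynomial.coeff f j ^ (p ^ l))" for f i
  have inner: "galois_inner p l (?W g) (?W f) = (\<Sum>i<k. Polynomial.coeff g i * row f i)"
    if "Polynomial.degree f < k" "Polynomial.degree g < k" for f g
    unfolding row_def by (rule galois_inner_grl_word[OF frob A s that])
  have dual: "?W f \<in> galois_dual p l (n + s) (GRL_code n k s a v A) \<longleftrightarrow> (\<forall>i<k. row f i = 0)"
    if f: "Polynomial.degree f < k" for f
  proof
    assume L: "?W f \<in> galois_dual p l (n + s) (GRL_code n k s a v A)"
    show "\<forall>i<k. row f i = 0"
    proof (intro allI impI)
      fix i assume i: "i < k"
      \<comment> \<open>Testing against the codeword of x^i isolates row \<open>i\<close>.\<close>
      have d: "Polynomial.degree (Polynomial.monom (1::'a) i) < k"
        using i by (simp add: Polynomial.degree_monom_eq)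
      have "galois_inner p l (?W (Polynomial.monom 1 i)) (?W f) = 0"
        using L d by (auto simp: galois_dual_def GRL_code_eq)
      then have "0 = (\<Sum>t<k. Polynomial.coeff (Polynomial.monom 1 i) t * row f t)"
        using inner[OF f d] by simp
      also have "\<dots> = (\<Sum>t<k. if t = i then row f t else 0)"
        by (intro sum.cong) auto
      finally show "row f i = 0"
        using i by simp
    qed
  next
    assume "\<forall>i<k. row f i = 0"
    then show "?W f \<in> galois_dual p l (n + s) (GRL_code n k s a v A)"
      using inner[OF f] grl_word_carrier[OF A] by (auto simp: galois_dual_def GRL_code_eq)
  qed
  \<comment> \<open>Raising to the power \<open>p ^ l\<close> does not change which coefficients are
    zero.\<close>
  have "(\<forall>i<k. row f i = 0) \<longleftrightarrow> (\<forall>j<k. Polynomial.coeff f j \<noteq> 0 \<longrightarrow> j \<in> J)" for f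
    unfolding row_def by (subst kernel) (use p in simp)
  then have supp: "Polynomial.degree f < k \<and> ?W f \<in> galois_dual p l (n + s) (GRL_code n k s a v A)
      \<longleftrightarrow> (\<forall>j. Polynomial.coeff f j \<noteq> 0 \<longrightarrow> j \<in> J)" for f
    using dual degree_less_supported_iff[OF J k] by metis
  have "galois_hull p l (n + s) (GRL_code n k s a v A)
      = ?W ` {f. Polynomial.degree f < k \<and> ?W f \<in> galois_dual p l (n + s) (GRL_code n k s a v A)}"
    unfolding galois_hull_def by (subst (1) GRL_code_eq) auto
  then show ?thesis
    by (simp only: supp)
qed

subsection \<open>The theorem\<close>

theorem mainTheorem4:
  fixes p e l n k \<xi> s :: nat
    and a :: "'a::{field, finite} vec"
    and u :: "nat \<Rightarrow> 'a"
    and K :: "'a set"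
  assumes "Factorial_Ring.prime p"
    and "card (UNIV :: 'a set) = p ^ e"
    and "p ^ e > 4"
    and "l > 0"
    and "2 * l dvd e"
    and "a \<in> carrier_vec n"
    and "\<forall>i<n. \<forall>j<n. i \<noteq> j \<longrightarrow> a $ i \<noteq> a $ j"
    and "\<forall>j<n. u j = (\<Prod>i\<in>{..<n} - {j}. inverse (a $ j - a $ i))"
    and "subfield K class_ring" and "card K = p ^ l"
    and "\<forall>j<n. a $ j \<noteq> 0 \<and> inverse (a $ j) * u j \<in> K - {0}"
    and "p ^ l + 1 dvd n" and "n div (p ^ l + 1) > 0"
    and "k = \<xi> + 1 + n div (p ^ l + 1)"
    and "\<xi> \<le> min (p ^ l - 1) ((n div (p ^ l + 1) - 1) div p ^ l)"
    and "\<xi> + 1 \<le> s" and "s \<le> min (\<xi> + p ^ l) (k - 1)"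
  shows "\<exists>C v A. GRL_params n k s a v A \<and> C = GRL_code n k s a v A \<and>
           linear_code (n + s) k C \<and>
           code_dim (n + s) (galois_hull p l (n + s) C) = k - s"
proof -

  \<comment> \<open>Parameters and index bounds\<close>
  define Q where "Q = p ^ l"
  define m where "m = n div (Q + 1)"
  have p: "p > 0"
    using assms(1) by (rule prime_gt_0_nat)
  then have Q: "Q > 0"
    by (simp add: Q_def)
  have n: "n = m * (Q + 1)"
    using assms(12) unfolding m_def Q_def by (rule dvd_div_mult_self[symmetric])
  then have n': "n = m + Q * m"
    by simp
  have m: "m > 0" and k: "k = \<xi> + 1 + m"
    using assms(13,14) by (simp_all add: m_def Q_def)
  have s: "\<xi> + 1 \<le> s" "s \<le> \<xi> + Q" "s < k"
    using assms(16,17) k by (auto simp: Q_def)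
  have "\<xi> \<le> Q - 1"
    using assms(15) by (simp add: Q_def)
  then have \<xi>: "\<xi> < Q"
    using Q by linarith
  have "Q * \<xi> \<le> Q * ((m - 1) div Q)"
    using assms(15) by (intro mult_le_mono2) (simp add: Q_def m_def)
  also have "\<dots> \<le> m - 1"
    by simp
  finally have Q\<xi>: "Q * \<xi> < m"
    using m by simp
  \<comment> \<open>The second bound places index \<open>m\<close> among those affected by
    \<open>A\<close>.\<close>
  have ks: "0 < k - s" "k - s \<le> m"
    using k s by auto
  have "Q \<le> Q * m"
    using m by simp
  then have kn: "k \<le> n"
    unfolding n' k using \<xi> by linarith
  have a_inj: "inj_on (($) a) {..<n}"
    using assms(7) by (intro inj_onI) (metis lessThan_iff)
  have frob: "(\<Sum>i\<in>I. x i) ^ (p ^ l) = (\<Sum>i\<in>I. x i ^ (p ^ l))" for x :: "nat \<Rightarrow> 'a" and I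
    by (rule sum_power_prime_power[OF assms(1,2)])

  \<comment> \<open>Norm equations and the multipliers \<open>v\<close>\<close>
  have norm: "\<exists>x. x ^ (Q + 1) = c" if "c \<in> K - {0}" for c
    using subfield_power_card_minus_1_eq_1[OF assms(9) that]
    unfolding Q_def by (intro ex_norm_eq[OF p assms(2,5)]) (simp only: assms(10))
  have "- 1 \<in> K - {0}"
    using subfield_class_ring_closed[OF assms(9)] by simp
  \<comment> \<open>\<open>b\<close> becomes the diagonal entry of \<open>A\<close> in its modified
    column: there \<open>b * b ^ Q\<close> cancels the moment of order \<open>n\<close>, which is
    1.\<close>
  then obtain b :: 'a where b: "b ^ (Q + 1) = - 1"
    using norm by blast
  then have b_0: "b \<noteq> 0"
    by auto
  have "\<forall>j<n. \<exists>x. x ^ (Q + 1) = inverse (a $ j) * u j"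
    using norm assms(11) by blast
  then obtain V where V: "\<And>j. j < n \<Longrightarrow> V j ^ (Q + 1) = inverse (a $ j) * u j"
    by metis
  define v where "v = vec n V"
  have v_0: "v $ j \<noteq> 0" if "j < n" for j
  proof
    assume "v $ j = 0"
    then have "inverse (a $ j) * u j = 0"
      using that V[OF that] by (simp add: v_def)
    then show False
      using assms(11) that by blast
  qed

  \<comment> \<open>Moments of the weights u_t/a_t\<close>
  define \<mu> where "\<mu> d = (\<Sum>t<n. v $ t ^ (Q + 1) * a $ t ^ d)" for d
  have \<mu>_eq: "\<mu> d = (\<Sum>t<n. inverse (a $ t) * u t * a $ t ^ d)" for d
    unfolding \<mu>_def by (intro sum.cong refl) (simp only: v_def index_vec V lessThan_iff)
  \<comment> \<open>For positive order one factor a_t cancels the inverse, leaving the interpolation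
    sum for X^(d-1), whose degree is below \<open>n\<close>.\<close>
  have \<mu>_pos: "\<mu> d = (if d = n then 1 else 0)" if d: "0 < d" "d \<le> n" for d
  proof -
    have "\<mu> d = (\<Sum>t<n. poly (Polynomial.monom 1 (d - 1)) (a $ t) * (\<Prod>i\<in>{..<n} - {t}. inverse (a $ t - a $ i)))"
      unfolding \<mu>_eq
    proof (intro sum.cong refl)
      fix t assume "t \<in> {..<n}"
      then have "t < n"
        by simp
      then have "a $ t \<noteq> 0" "u t = (\<Prod>i\<in>{..<n} - {t}. inverse (a $ t - a $ i))"
        using assms(8,11) by blast+
      moreover have "a $ t ^ d = a $ t * a $ t ^ (d - 1)"
        using d by (cases d) simp_all
      ultimately show "inverse (a $ t) * u t * a $ t ^ d =
          poly (Polynomial.monom 1 (d - 1)) (a $ t) * (\<Prod>i\<in>{..<n} - {t}. inverse (a $ t - a $ i))"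
        by (simp add: poly_monom)
    qed
    also have "\<dots> = Polynomial.coeff (Polynomial.monom 1 (d - 1)) (n - 1)"
      using d by (intro sum_poly_lagrange_weights[OF a_inj]) (simp add: Polynomial.degree_monom_eq)
    also have "\<dots> = (if d = n then 1 else 0)"
      using d by auto
    finally show ?thesis .
  qed
  have "\<mu> 0 = (\<Sum>t<n. inverse (a $ t) * (\<Prod>i\<in>{..<n} - {t}. inverse (a $ t - a $ i)))"
    unfolding \<mu>_eq using assms(8) by (intro sum.cong refl) simp
  then have \<mu>_0: "\<mu> 0 \<noteq> 0"
    using sum_inverse_lagrange_weights_nonzero[OF a_inj] assms(11) kn k by simp
  \<comment> \<open>A is chosen so that column m of the Gram matrix of the code vanishes, while its columns
    with index from k - s to m - 1 are unit vectors.\<close>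
  define c0 where "c0 = m - (k - s)"
  have c0: "c0 < s" "k - s + c0 = m"
    using ks k s by (auto simp: c0_def)
  define A where "A = mat s s (\<lambda>(r, c).
    if c = c0 then - (\<mu> (k - s + r + Q * m) / b ^ Q) else if r = c then 1 else 0)"
  have A: "A \<in> carrier_mat s s"
    by (simp add: A_def)
  have A_c0: "A $$ (r, c0) = - (\<mu> (k - s + r + Q * m) / b ^ Q)" if "r < s" for r
    using that c0 by (simp add: A_def)
  have A_other: "A $$ (r, c) = (if r = c then 1 else 0)" if "r < s" "c < s" "c \<noteq> c0" for r c
    using that by (simp add: A_def)
  \<comment> \<open>Above the diagonal the modified column holds moments of order strictly between 0
    and \<open>n\<close>, so \<open>A\<close> is lower triangular.\<close>
  have A_upper: "A $$ (r, c0) = 0" if "r < c0" for r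
  proof -
    have "k - s + r < m"
      using that c0(2) by simp
    then have "0 < k - s + r + Q * m" "k - s + r + Q * m < n"
      using ks unfolding n' by linarith+
    then show ?thesis
      using that c0 \<mu>_pos by (simp add: A_c0)
  qed
  have A_diag: "A $$ (c0, c0) = b"
  proof -
    have "\<mu> (k - s + c0 + Q * m) = 1"
      using \<mu>_pos[of n] m unfolding c0(2) n' by simp
    then have "A $$ (c0, c0) = - 1 / b ^ Q"
      using A_c0[OF c0(1)] by simp
    also have "\<dots> = b"
      unfolding b[symmetric] using b_0 by simp
    finally show ?thesis .
  qed
  have "invertible_mat A"
  proof (rule invertible_mat_lower_triangular[OF A])
    show "A $$ (i, j) = 0" if "i < j" "j < s" for i j
      using that A_upper A_other by (cases "j = c0") auto
    show "A $$ (i, i) \<noteq> 0" if "i < s" for i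
      using that A_diag A_other b_0 by (cases "i = c0") auto
  qed
  then have P: "GRL_params n k s a v A"
    using s kn A assms(6,7) v_0 by (auto simp: GRL_params_def v_def)

  \<comment> \<open>The Gram matrix of the code\<close>
  define G where "G i j = (\<Sum>c<n + s. grl_gen n k s a v A i c * grl_gen n k s a v A j c ^ (p ^ l))" for i j
  have G: "G i j = \<mu> (i + Q * j) +
    (if k - s \<le> i \<and> k - s \<le> j then \<Sum>c<s. A $$ (i - (k - s), c) * A $$ (j - (k - s), c) ^ Q else 0)" for i j
    unfolding G_def \<mu>_def Q_def[symmetric] by (rule sum_grl_gen_mult[OF Q])
  \<comment> \<open>The order is at most (\<xi> + m) + Q(m - 1), which is below n because \<xi> <
    Q.\<close>
  have \<mu>_col: "\<mu> (i + Q * j) = 0" if "i < k" "j < m" "0 < i" for i j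
  proof -
    have "Q * j \<le> Q * (m - 1)"
      using that by (intro mult_le_mono2) linarith
    also have "\<dots> = Q * m - Q"
      by (simp add: algebra_simps)
    finally have "Q * j \<le> Q * m - Q" .
    then have "i + Q * j < n"
      using \<open>i < k\<close> \<open>Q \<le> Q * m\<close> \<xi> unfolding n' k by linarith
    then show ?thesis
      using \<mu>_pos that by simp
  qed
  \<comment> \<open>The rows of \<open>A\<close> with index \<open>t < c0\<close> are unit vectors,
    so the sum picks out the entry of \<open>A\<close> at \<open>(r, t)\<close>, and the moment
    vanishes.\<close>
  have G_block: "G i j = (if i = j then 1 else 0)" if "k - s \<le> i" "i < k" "k - s \<le> j" "j < m" for i j
  proof -
    define r t where "r = i - (k - s)" and "t = j - (k - s)"
    have rt: "r < s" "t < c0" "t < s" "i = j \<longleftrightarrow> r = t"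
      using that c0 s by (auto simp: r_def t_def)
    have "(\<Sum>c<s. A $$ (r, c) * A $$ (t, c) ^ Q) = (\<Sum>c<s. if c = t then A $$ (r, t) else 0)"
    proof (intro sum.cong refl)
      fix c assume "c \<in> {..<s}"
      then show "A $$ (r, c) * A $$ (t, c) ^ Q = (if c = t then A $$ (r, t) else 0)"
        using rt Q A_other[of t c] A_upper[of t] by (cases "c = c0") auto
    qed
    also have "\<dots> = (if r = t then 1 else 0)"
      using rt A_other[of r t] by simp
    finally show ?thesis
      using \<mu>_col[of i j] that ks rt by (simp add: G r_def t_def)
  qed
  \<comment> \<open>Row \<open>c0\<close> of \<open>A\<close> is \<open>b\<close> times a unit
    vector. From \<open>k - s\<close> on, the contribution of \<open>A\<close> is therefore its
    entry at \<open>(r, c0)\<close> times \<open>b ^ Q\<close>, which was defined to be minus the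
    moment; before that, the moment itself is zero.\<close>
  have G_m: "G i m = 0" if i: "i < k" for i
  proof (cases "i < k - s")
    case True
    then have "0 < i + Q * m" "i + Q * m < n"
      using ks Q m by (auto simp: n')
    then show ?thesis
      using True \<mu>_pos by (simp add: G)
  next
    case False
    define r where "r = i - (k - s)"
    have r: "r < s" "k - s + r = i"
      using False i s by (auto simp: r_def)
    have "(\<Sum>c<s. A $$ (r, c) * A $$ (c0, c) ^ Q) = (\<Sum>c<s. if c = c0 then A $$ (r, c0) * b ^ Q else 0)"
    proof (intro sum.cong refl)
      fix c assume "c \<in> {..<s}"
      then show "A $$ (r, c) * A $$ (c0, c) ^ Q = (if c = c0 then A $$ (r, c0) * b ^ Q else 0)"
        using c0 Q A_other[of c0 c] A_diag by (cases "c = c0") auto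
    qed
    also have "\<dots> = - \<mu> (i + Q * m)"
      using c0 r A_c0[OF r(1)] b_0 by simp
    finally show ?thesis
      using False ks by (simp add: G r_def c0_def)
  qed

  \<comment> \<open>The hull and the two dimensions\<close>
  define J where "J = insert m {1..<k - s}"
  have kernel: "(\<forall>i<k. (\<Sum>j<k. G i j * y j) = 0) \<longleftrightarrow> (\<forall>j<k. y j \<noteq> 0 \<longrightarrow> j \<in> J)" for y
    unfolding J_def
  proof (rule hull_system_iff[OF k s \<xi> Q\<xi>])
    show "G 0 0 \<noteq> 0"
      using ks \<mu>_0 by (simp add: G)
    show "G i j = 0" if "i < k - s" "j < k" "0 < i + Q * j" "i + Q * j < m * (Q + 1)" for i j
      using that \<mu>_pos[of "i + Q * j"] by (simp add: G n)
    show "G i j = 1" if "i < k - s" "j < k" "i + Q * j = m * (Q + 1)" for i j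
      using that \<mu>_pos[of n] m by (simp add: G n)
    show "G i j = 0" if "k - s \<le> i" "i < k" "j < k - s" for i j
      using that \<mu>_col[of i j] ks by (simp add: G)
  qed (fact G_block G_m)+
  \<comment> \<open>The interval has \<open>k - s - 1\<close> elements, and \<open>m\<close> is not
    among them because k - s \<le> m.\<close>
  have J: "J \<subseteq> {..<k}" "card J = k - s"
    using ks k by (auto simp: J_def)
  have hull: "galois_hull p l (n + s) (GRL_code n k s a v A) =
    grl_word n k s a v A ` {f. \<forall>j. Polynomial.coeff f j \<noteq> 0 \<longrightarrow> j \<in> J}"
    by (rule galois_hull_GRL_code[OF frob p P J(1)]) (rule kernel[unfolded G_def])
  have "Polynomial.degree f < k \<longleftrightarrow> (\<forall>j. Polynomial.coeff f j \<noteq> 0 \<longrightarrow> j \<in> {..<k})" for f :: "'a poly"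
    using degree_less_supported_iff[of "{..<k}" k f] k by simp
  then have "GRL_code n k s a v A = grl_word n k s a v A ` {f. \<forall>j. Polynomial.coeff f j \<noteq> 0 \<longrightarrow> j \<in> {..<k}}"
    by (simp only: GRL_code_eq)
  then have "linear_code (n + s) k (GRL_code n k s a v A)"
    using linear_code_grl_word_supported[OF P subset_refl] by (simp only: card_lessThan)
  moreover have "code_dim (n + s) (galois_hull p l (n + s) (GRL_code n k s a v A)) = k - s"
    using linear_code_grl_word_supported[OF P J(1)] J(2) by (simp add: linear_code_def hull)
  ultimately show ?thesis
    using P by blast
qed

end
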